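(* Let $\alpha>0$, $\beta>-1$, $\sigma>0$, let $F$ be the CDF of the $MLM(\alpha,\beta,\sigma)$ distribution, and let $G$ be the CDF of the power-law distribution given by $1-G(x)=\left(1+\frac{x}{\sigma}\right)^{-\alpha}$ for $x>0$. Then $F$ is right tail-equivalent to $G$; that is, there is a constant $c$ with $0<c<\infty$ such that $$\lim_{x\to\infty}\frac{1-F(x)}{1-G(x)}=c.$$
   Context: For $\alpha>0$, $\beta>-1$, $\sigma>0$, the modified Lomax distribution $MLM(\alpha,\beta,\sigma)$ has CDF $$F(x)=1-\exp\left[-\alpha\,\frac{\left(\log(1+x/\sigma)\right)^{\beta+1}}{\left(1+\log(1+x/\sigma)\right)^{\beta}}\right]\quad (x>0),\qquad F(x)=0\quad (x\le 0).$$ Two distributions $F$ and $G$ are said to be (right) tail-equivalent if $\lim_{x\to\infty}\frac{1-F(x)}{1-G(x)}=c$ for some $0<c<\infty$. *)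

theory Defs
  imports Complex_Main
begin

definition mlm_cdf :: "real \<Rightarrow> real \<Rightarrow> real \<Rightarrow> real \<Rightarrow> real" where
  "mlm_cdf \<alpha> \<beta> \<sigma> x =
     (if x > 0 then
        1 - exp (- (\<alpha> * (ln (1 + x / \<sigma>) powr (\<beta> + 1) / (1 + ln (1 + x / \<sigma>)) powr \<beta>)))
      else 0)"

text \<open>
  The survival function tends to 1 as x decreases to 0, so the value 0 for
  nonpositive arguments is forced by monotonicity and nonnegativity of a CDF.
\<close>

definition power_law_cdf :: "real \<Rightarrow> real \<Rightarrow> real \<Rightarrow> real" where
  "power_law_cdf \<alpha> \<sigma> x = (if x > 0 then 1 - (1 + x / \<sigma>) powr (- \<alpha>) else 0)"

definition right_tail_equivalent :: "(real \<Rightarrow> real) \<Rightarrow> (real \<Rightarrow> real) \<Rightarrow> bool" where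
  "right_tail_equivalent F G \<longleftrightarrow>
     (\<exists>c::real. 0 < c \<and> ((\<lambda>x. (1 - F x) / (1 - G x)) \<longlongrightarrow> c) at_top)"

end

theory Submission
  imports Defs "HOL-Real_Asymp.Real_Asymp"
begin

text \<open>
  With \<open>L = ln (1 + x / \<sigma>)\<close>, the ratio of the survival functions is
  \<open>exp (\<alpha> * (L - L powr (\<beta> + 1) / (1 + L) powr \<beta>))\<close>. Since
  \<open>L * (1 + 1 / L) powr (- \<beta>) = L - \<beta> + o(1)\<close>, it tends to \<open>exp (\<alpha> * \<beta>)\<close>.
\<close>

lemma tendsto_diff_powr_quotient:
  fixes \<beta> :: real
  shows "((\<lambda>y. y - y powr (\<beta> + 1) / (1 + y) powr \<beta>) \<longlongrightarrow> \<beta>) at_top"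
proof -
  \<comment> \<open>In this form the binomial expansion in \<open>1 / y\<close> applies:
    \<open>(1 + 1 / y) powr (- \<beta>)\<close> is 1 - \<beta>/y + O(1/y^2), so the leading terms
    cancel.\<close>
  have "((\<lambda>y::real. y - y * (1 + 1 / y) powr (- \<beta>)) \<longlongrightarrow> \<beta>) at_top"
    by real_asymp
  moreover have "\<forall>\<^sub>F y::real in at_top.
      y - y * (1 + 1 / y) powr (- \<beta>) = y - y powr (\<beta> + 1) / (1 + y) powr \<beta>"
    using eventually_gt_at_top[of 0]
  proof eventually_elim
    case (elim y)
    then have "1 + 1 / y = (1 + y) / y"
      by (simp add: field_simps)
    with elim show ?case
      by (simp add: powr_divide powr_minus powr_add divide_simps algebra_simps)
  qed
  ultimately show ?thesis
    by (rule Lim_transform_eventually)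
qed

text \<open>Both survival functions are exponentials in \<open>L\<close>, the power law being
  \<open>exp (- \<alpha> * L)\<close>, so dividing them subtracts exponents.\<close>

lemma survival_ratio_eq:
  fixes \<alpha> \<beta> \<sigma> x :: real
  assumes "\<sigma> > 0" and "x > 0"
  defines "L \<equiv> ln (1 + x / \<sigma>)"
  shows "(1 - mlm_cdf \<alpha> \<beta> \<sigma> x) / (1 - power_law_cdf \<alpha> \<sigma> x) =
    exp (\<alpha> * (L - L powr (\<beta> + 1) / (1 + L) powr \<beta>))"
proof -
  \<comment> \<open>Positivity excludes the case of base 0 in \<open>powr_def\<close>, where
    \<open>powr\<close> is 0 by convention.\<close>
  have "1 + x / \<sigma> > 0"
    using assms by (simp add: add_pos_pos)
  then have "(1 + x / \<sigma>) powr (- \<alpha>) = exp (- \<alpha> * L)"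
    by (simp add: powr_def L_def)
  then show ?thesis
    using assms(2)
    by (simp add: mlm_cdf_def power_law_cdf_def L_def exp_diff[symmetric] right_diff_distrib)
qed

theorem theorem4:
  fixes \<alpha> \<beta> \<sigma> :: real
  assumes "\<alpha> > 0" and "\<beta> > -1" and "\<sigma> > 0"
  shows "right_tail_equivalent (mlm_cdf \<alpha> \<beta> \<sigma>) (power_law_cdf \<alpha> \<sigma>)"
proof -
  let ?L = "\<lambda>x. ln (1 + x / \<sigma>)"
  have "filterlim ?L at_top at_top"
    using \<open>\<sigma> > 0\<close> by real_asymp
  \<comment> \<open>Substitute y = \<open>?L x\<close>, which tends to infinity with x.\<close>
  then have "((\<lambda>x. ?L x - ?L x powr (\<beta> + 1) / (1 + ?L x) powr \<beta>) \<longlongrightarrow> \<beta>) at_top"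
    by (rule filterlim_compose[OF tendsto_diff_powr_quotient])
  then have "((\<lambda>x. exp (\<alpha> * (?L x - ?L x powr (\<beta> + 1) / (1 + ?L x) powr \<beta>)))
      \<longlongrightarrow> exp (\<alpha> * \<beta>)) at_top"
    by (intro tendsto_intros)
  moreover have "\<forall>\<^sub>F x in at_top.
      exp (\<alpha> * (?L x - ?L x powr (\<beta> + 1) / (1 + ?L x) powr \<beta>)) =
      (1 - mlm_cdf \<alpha> \<beta> \<sigma> x) / (1 - power_law_cdf \<alpha> \<sigma> x)"
    using eventually_gt_at_top[of 0]
    by eventually_elim (simp add: survival_ratio_eq[OF \<open>\<sigma> > 0\<close>])
  ultimately have "((\<lambda>x. (1 - mlm_cdf \<alpha> \<beta> \<sigma> x) / (1 - power_law_cdf \<alpha> \<sigma> x))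
      \<longlongrightarrow> exp (\<alpha> * \<beta>)) at_top"
    by (rule Lim_transform_eventually)
  \<comment> \<open>The limit \<open>exp (\<alpha> * \<beta>)\<close> serves as the constant; as an
    exponential it is positive even when \<beta> is negative.\<close>
  then show ?thesis
    unfolding right_tail_equivalent_def by (intro exI[of _ "exp (\<alpha> * \<beta>)"] conjI) simp_all
qed

end
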